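(* Let $(X,d)$ be a proper metric space, and let $\mu$ be a locally finite Borel measure on $X$. Let $\{A_n\}_{n=1}^\infty$ be a sequence of nonempty compact subsets of $X$ converging in the Hausdorff distance to a nonempty compact set $A_\infty\subseteq X$, i.e. $\delta_n := d_H(A_n,A_\infty)\to 0$ as $n\to\infty$. Then $$\lim_{n\to\infty}\mu\big(A_n^{(\delta_n)}\big)=\mu(A_\infty).$$
   Context: A metric space is proper if every closed and bounded subset is compact. A Borel measure $\mu$ on $X$ (a nonnegative measure on the Borel $\sigma$-algebra) is locally finite if every point $x\in X$ has a neighborhood $U_x$ with $\mu(U_x)<\infty$. For nonempty $A,B\subseteq X$, the Hausdorff distance is $d_H(A,B)=\max\{\sup_{a\in A}d(a,B),\ \sup_{b\in B}d(b,A)\}$, where $d(a,B)=\inf_{b\in B}d(a,b)$. For nonempty $A\subseteq X$ and $\delta\ge 0$, the $\delta$-fattening of $A$ is $A^{(\delta)}=\bigcup_{a\in A}\overline{B}_\delta(a)$, where $\overline{B}_\delta(a)=\{x\in X: d(x,a)\le\delta\}$. *)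

theory Defs
  imports "HOL-Analysis.Analysis"
begin

(* Membership of U in sets M is essential: emeasure is 0 on non-measurable sets. *)
definition locally_finite_measure :: "'a::metric_space measure \<Rightarrow> bool" where
  "locally_finite_measure M \<longleftrightarrow>
     (\<forall>x. \<exists>U\<in>sets M. x \<in> interior U \<and> emeasure M U < \<infinity>)"

(* The suprema are taken in the reals, so this is the Hausdorff distance only where it is
   finite, e.g. for nonempty bounded A and B. *)
definition hausdorff_dist :: "'a::metric_space set \<Rightarrow> 'a set \<Rightarrow> real" where
  "hausdorff_dist A B = max (SUP a\<in>A. infdist a B) (SUP b\<in>B. infdist b A)"

definition fattening :: "'a::metric_space set \<Rightarrow> real \<Rightarrow> 'a set" where
  "fattening A \<delta> = (\<Union>a\<in>A. cball a \<delta>)"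

end

(* Both fattenings and neighbourhoods of A_inf are closed sublevel sets of the distance function.
   The definition of the Hausdorff distance gives
   A_inf \<subseteq> A_n^(\<delta>_n) \<subseteq> {x. d(x, A_inf) \<le> 2 \<delta>_n}; the right-hand sets are compact, hence of finite
   measure, and decrease to A_inf, so continuity from above squeezes the measures. *)
theory Submission
  imports Defs
begin

text \<open>Finitely many interiors of finite-measure neighbourhoods cover \<open>K\<close>, and
  finite subadditivity bounds its measure.\<close>

lemma emeasure_compact_finite:
  fixes M :: "'a::metric_space measure"
  assumes sets: "sets M = sets borel" and lf: "locally_finite_measure M" and K: "compact K"
  shows "emeasure M K < \<infinity>"
proof -
  obtain U where U: "\<And>x. U x \<in> sets M" "\<And>x. x \<in> interior (U x)" "\<And>x. emeasure M (U x) < \<infinity>"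
  proof -
    have "\<forall>x. \<exists>U. U \<in> sets M \<and> x \<in> interior U \<and> emeasure M U < \<infinity>"
      using lf unfolding locally_finite_measure_def by blast
    then show ?thesis
      using that by (auto dest!: choice)
  qed
  obtain T where T: "finite T" "K \<subseteq> (\<Union>x\<in>T. interior (U x))"
  proof -
    have "K \<subseteq> (\<Union>x\<in>K. interior (U x))"
      using U(2) by auto
    with K show ?thesis
      by (rule compactE_image[OF _ open_interior]) (rule that)
  qed
  have "K \<subseteq> (\<Union>x\<in>T. U x)"
    using T(2) by (rule order_trans) (intro UN_mono subset_refl interior_subset)
  then have "emeasure M K \<le> emeasure M (\<Union>x\<in>T. U x)"
    using T(1) U(1) by (intro emeasure_mono sets.finite_UN) auto
  also have "\<dots> \<le> (\<Sum>x\<in>T. emeasure M (U x))"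
    using T(1) U(1) by (intro emeasure_subadditive_finite) auto
  also have "\<dots> < \<infinity>"
    using U(3) by (simp add: T(1) less_top)
  finally show ?thesis .
qed

text \<open>Compactness makes the infimum attained, so a point at distance exactly \<open>r\<close>
  still lies in a closed ball around some point of \<open>A\<close>.\<close>

lemma fattening_eq_infdist_le:
  fixes A :: "'a::metric_space set"
  assumes "compact A" "A \<noteq> {}"
  shows "fattening A r = {x. infdist x A \<le> r}"
proof (intro equalityI subsetI)
  fix x assume "x \<in> fattening A r"
  then obtain a where "a \<in> A" "dist x a \<le> r"
    by (auto simp: fattening_def dist_commute)
  then show "x \<in> {x. infdist x A \<le> r}"
    using infdist_le[of a A x] by simp
next
  fix x assume "x \<in> {x. infdist x A \<le> r}"
  moreover obtain a where a: "a \<in> A" "\<And>b. b \<in> A \<Longrightarrow> dist x a \<le> dist x b"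
    using continuous_attains_inf[OF assms, of "dist x"]
      continuous_on_dist[OF continuous_on_const continuous_on_id] by blast
  then have "dist x a \<le> infdist x A"
    using assms(2) by (auto simp: infdist_notempty intro: cINF_greatest)
  ultimately show "x \<in> fattening A r"
    using a(1) by (force simp: fattening_def dist_commute)
qed

lemma closed_infdist_le: "closed {x. infdist x A \<le> r}"
  by (intro closed_Collect_le continuous_intros)

lemma bounded_infdist_le:
  fixes A :: "'a::metric_space set"
  assumes "bounded A" "A \<noteq> {}"
  shows "bounded {x. infdist x A \<le> r}"
proof -
  obtain c R where R: "\<And>a. a \<in> A \<Longrightarrow> dist c a \<le> R"
    using assms(1) unfolding bounded_def by blast
  \<comment> \<open>The infimum need not be attained here; the slack 1 yields a point of
    \<open>A\<close> at distance less than \<open>r + 1\<close>.\<close>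
  have "dist c x \<le> R + (r + 1)" if x: "infdist x A \<le> r" for x
  proof -
    obtain a where "a \<in> A" "dist x a < r + 1"
      using x assms(2) cINF_less_iff[OF assms(2) bdd_below_image_dist, of x "r + 1"]
      by (auto simp: infdist_notempty)
    then show ?thesis
      using R[of a] dist_triangle[of c x a] by (simp add: dist_commute)
  qed
  then show ?thesis
    unfolding bounded_def by blast
qed

text \<open>A real \<open>SUP\<close> dominates its terms only when they are bounded above; this
  makes both suprema in \<open>hausdorff_dist\<close> genuine upper bounds.\<close>

lemma bdd_above_infdist_image:
  fixes A :: "'a::metric_space set"
  assumes "compact A"
  shows "bdd_above ((\<lambda>a. infdist a B) ` A)"
  by (intro bounded_imp_bdd_above compact_imp_bounded compact_continuous_image assms continuous_intros)

lemma infdist_le_hausdorff_dist: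
  fixes A B :: "'a::metric_space set"
  assumes "compact A" "compact B"
  shows "a \<in> A \<Longrightarrow> infdist a B \<le> hausdorff_dist A B"
    and "b \<in> B \<Longrightarrow> infdist b A \<le> hausdorff_dist A B"
  using cSUP_upper[OF _ bdd_above_infdist_image[OF assms(1)], of a B]
    cSUP_upper[OF _ bdd_above_infdist_image[OF assms(2)], of b A]
  unfolding hausdorff_dist_def by linarith+

lemma subset_fattening_hausdorff_dist:
  fixes A B :: "'a::metric_space set"
  assumes "compact A" "A \<noteq> {}" "compact B"
  shows "B \<subseteq> fattening A (hausdorff_dist A B)"
  using assms infdist_le_hausdorff_dist(2) by (auto simp: fattening_eq_infdist_le)

text \<open>The factor 2 comes from \<open>d(x,B) \<le> d(x,a) + d(a,B)\<close>: the first term is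
  bounded by the radius of the fattening, the second by the Hausdorff distance.\<close>

lemma fattening_hausdorff_dist_subset:
  fixes A B :: "'a::metric_space set"
  assumes "compact A" "compact B"
  shows "fattening A (hausdorff_dist A B) \<subseteq> {x. infdist x B \<le> 2 * hausdorff_dist A B}"
proof
  fix x assume "x \<in> fattening A (hausdorff_dist A B)"
  then obtain a where a: "a \<in> A" "dist x a \<le> hausdorff_dist A B"
    by (auto simp: fattening_def dist_commute)
  then show "x \<in> {x. infdist x B \<le> 2 * hausdorff_dist A B}"
    using infdist_le_hausdorff_dist(1)[OF assms a(1)] infdist_triangle[of x B a] by simp
qed

text \<open>Continuity from above requires a decreasing sequence of sets, and the radii
  \<open>2 * \<delta> n\<close> need not decrease. The radii \<open>1/(k+1)\<close> do, and
  closedness of \<open>A\<close> identifies the intersection.\<close>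

lemma tendsto_emeasure_infdist_le:
  fixes M :: "'a::metric_space measure"
  assumes sets: "sets M = sets borel" and A: "closed A" "A \<noteq> {}"
    and fin: "\<And>r. emeasure M {x. infdist x A \<le> r} < \<infinity>"
  shows "(\<lambda>k. emeasure M {x. infdist x A \<le> inverse (real (Suc k))}) \<longlonglongrightarrow> emeasure M A"
proof -
  let ?F = "\<lambda>k. {x. infdist x A \<le> inverse (real (Suc k))}"
  have "x \<in> A" if "\<And>k. infdist x A \<le> inverse (real (Suc k))" for x
  proof -
    have "infdist x A \<le> 0"
      using LIMSEQ_le_const[OF LIMSEQ_inverse_real_of_nat] that by blast
    then show ?thesis
      using in_closed_iff_infdist_zero[OF A] infdist_nonneg[of x A] by simp
  qed
  then have "(\<Inter>k. ?F k) \<subseteq> A"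
    by blast
  moreover have "A \<subseteq> (\<Inter>k. ?F k)"
    by auto
  ultimately have Inter: "(\<Inter>k. ?F k) = A"
    by (rule equalityI)
  have "(\<lambda>k. emeasure M (?F k)) \<longlonglongrightarrow> emeasure M (\<Inter>k. ?F k)"
  proof (rule Lim_emeasure_decseq)
    show "range ?F \<subseteq> sets M"
      using borel_closed[OF closed_infdist_le] sets by blast
    show "decseq ?F"
    proof (rule decseq_SucI)
      fix k
      have "inverse (real (Suc (Suc k))) \<le> inverse (real (Suc k))"
        by (intro le_imp_inverse_le) simp_all
      then show "?F (Suc k) \<subseteq> ?F k"
        by (meson Collect_mono order_trans)
    qed
    show "emeasure M (?F k) \<noteq> \<infinity>" for k
      using fin[of "inverse (real (Suc k))"] by simp
  qed
  then show ?thesis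
    by (simp only: Inter)
qed

theorem theorem1p1:
  fixes \<mu> :: "'a::metric_space measure"
    and A :: "nat \<Rightarrow> 'a set" and A_inf :: "'a set" and \<delta> :: "nat \<Rightarrow> real"
  assumes proper: "\<And>S :: 'a set. closed S \<Longrightarrow> bounded S \<Longrightarrow> compact S"
    and borel_measure: "sets \<mu> = sets borel"
    and locally_finite: "locally_finite_measure \<mu>"
    and A: "\<And>n. n \<ge> 1 \<Longrightarrow> A n \<noteq> {} \<and> compact (A n)"
    and A_inf: "A_inf \<noteq> {}" "compact A_inf"
    and \<delta>: "\<And>n. n \<ge> 1 \<Longrightarrow> \<delta> n = hausdorff_dist (A n) A_inf"
    and conv: "\<delta> \<longlonglongrightarrow> 0"
  shows "(\<lambda>n. emeasure \<mu> (fattening (A n) (\<delta> n))) \<longlonglongrightarrow> emeasure \<mu> A_inf"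
proof (rule order_tendstoI)
  let ?F = "\<lambda>r. {x. infdist x A_inf \<le> r}"
  let ?G = "\<lambda>n. fattening (A n) (\<delta> n)"
  have F_sets: "{x. infdist x B \<le> r} \<in> sets \<mu>" for B r
    using borel_closed[OF closed_infdist_le] borel_measure by blast
  \<comment> \<open>The restriction \<open>n \<ge> 1\<close> recurs because nothing is assumed about
    \<open>A 0\<close> and \<open>\<delta> 0\<close>.\<close>
  have lower: "emeasure \<mu> A_inf \<le> emeasure \<mu> (?G n)" if "n \<ge> 1" for n
  proof (rule emeasure_mono)
    show "A_inf \<subseteq> ?G n"
      using subset_fattening_hausdorff_dist A A_inf \<delta> that by metis
    \<comment> \<open>A fattening may be an uncountable union of balls; its measurability comes from
      being a closed sublevel set of \<open>infdist\<close>.\<close>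
    show "?G n \<in> sets \<mu>"
      using F_sets A[OF that] by (simp add: fattening_eq_infdist_le)
  qed
  have upper: "?G n \<subseteq> ?F (2 * \<delta> n)" if "n \<ge> 1" for n
    using fattening_hausdorff_dist_subset A A_inf \<delta> that by metis
  \<comment> \<open>Properness enters here: \<open>?F r\<close> is closed and bounded, hence
    compact.\<close>
  have "emeasure \<mu> (?F r) < \<infinity>" for r
    using emeasure_compact_finite[OF borel_measure locally_finite proper]
      closed_infdist_le bounded_infdist_le[OF compact_imp_bounded] A_inf by blast
  then have lim: "(\<lambda>k. emeasure \<mu> (?F (inverse (real (Suc k))))) \<longlonglongrightarrow> emeasure \<mu> A_inf"
    using tendsto_emeasure_infdist_le[OF borel_measure compact_imp_closed] A_inf by blast
  show "\<forall>\<^sub>F n in sequentially. c < emeasure \<mu> (?G n)" if "c < emeasure \<mu> A_inf" for c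
    using eventually_ge_at_top[of 1] by eventually_elim (use lower that in \<open>auto intro: less_le_trans\<close>)
  show "\<forall>\<^sub>F n in sequentially. emeasure \<mu> (?G n) < c" if c: "emeasure \<mu> A_inf < c" for c
  proof -
    \<comment> \<open>First fix one neighbourhood of \<open>A_inf\<close> with measure below
      \<open>c\<close>; all late fattenings then lie inside it, since \<open>2 * \<delta> n\<close>
      drops below its radius.\<close>
    obtain k where k: "emeasure \<mu> (?F (inverse (real (Suc k)))) < c"
      using order_tendstoD(2)[OF lim c] by (auto simp: eventually_sequentially)
    have "(\<lambda>n. 2 * \<delta> n) \<longlonglongrightarrow> 0"
      using tendsto_mult_left[OF conv, of 2] by simp
    then have "\<forall>\<^sub>F n in sequentially. 2 * \<delta> n < inverse (real (Suc k))"
      by (rule order_tendstoD) simp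
    then show ?thesis
      using eventually_ge_at_top[of 1]
    proof eventually_elim
      case (elim n)
      then have "?G n \<subseteq> ?F (inverse (real (Suc k)))"
        using upper[of n] by auto
      then show ?case
        using emeasure_mono[OF _ F_sets] k by (blast intro: le_less_trans)
    qed
  qed
qed

end
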